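(* Each of the following thirteen two-sided frieze types can be realised in hitomezashi, i.e. for each of them there is a hitomezashi two-sided frieze of exactly that type: $\mathrm{p111}$, $\mathrm{p112}$, $\mathrm{p}11\tilde2$, $\mathrm{p11a}$, $\mathrm{p}11\stackrel{2}{\mathrm a}$, $\mathrm{p1a1}$, $\mathrm{p1m1}$, $\mathrm{pm11}$, $\mathrm{pma2}$, $\mathrm{pmm2}$, $\mathrm{p}2'11$, $\mathrm{p}\stackrel{2'}{\mathrm m}11$, $\mathrm{p}2'\mathrm{ma}$.
   Context: **Hitomezashi two-sided friezes.** Let $x=(x_i)_{i\in\mathbb Z}$ be a periodic bi-infinite binary sequence (given by indefinite repetition of a finite binary word), and let $y=y_1\cdots y_n$ be a finite binary word with $n=|y|\ge 2$. The grid edges of the strip are the vertical unit edges from $(i,j)$ to $(i,j+1)$ for $i\in\mathbb Z$, $1\le j\le n-1$, and the horizontal unit edges from $(i,j)$ to $(i+1,j)$ for $i\in\mathbb Z$, $1\le j\le n$. Stitches and gaps alternate along each line. On the front, the vertical edge from $(i,j)$ to $(i,j+1)$ carries a stitch iff ($x_i=1$ and $j$ odd) or ($x_i=0$ and $j$ even); the horizontal edge from $(i,j)$ to $(i+1,j)$ carries a stitch iff ($y_j=1$ and $i$ even) or ($y_j=0$ and $i$ odd). Let $F$ be the set of edges carrying a stitch on the front. On the back, a stitch lies behind each gap of the front and a gap behind each stitch, so the set $B$ of edges stitched on the back (in the same planar coordinates) is the complement of $F$ in the set of all grid edges. The pair $(F,B)$ is the hitomezashi two-sided frieze given by $x,y$.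 **Symmetries.** Axis $\mathbf a$ is the horizontal central line of the strip in the frieze plane, $\mathbf b$ is perpendicular to $\mathbf a$ in the frieze plane, and $\mathbf c$ is perpendicular to the frieze plane. A candidate isometry is a quadruple $(s,t,e,d)$ with $s,e,d\in\{+1,-1\}$, $t\in\mathbb R$. It acts on the plane by $X\mapsto sX+t$ on the horizontal coordinate, fixes the vertical coordinate if $e=+1$, sends it to $Y\mapsto n+1-Y$ if $e=-1$, and keeps the two sides if $d=+1$ or exchanges them if $d=-1$. It is a symmetry of $(F,B)$ if its planar action maps $F$ to $F$ and $B$ to $B$ (case $d=+1$), or $F$ to $B$ and $B$ to $F$ (case $d=-1$). The symmetries form a group $G$, whose pure translations $(+1,t,+1,+1)$ are those with $t\in T\mathbb Z$ for some $T>0$. **Labels.** A two-sided frieze type has a label $\mathrm{p}\ast\ast\ast$ whose second, third and fourth positions describe symmetry relative to $\mathbf a$, $\mathbf b$, $\mathbf c$ respectively. Symbols: $1$ is a placeholder; $\mathrm m$ is reflection in a plane perpendicular to the axis; $\mathrm a$ is glide reflection, the reflection being in a plane perpendicular to the axis and the glide parallel to $\mathbf a$; $2$ is rotation by $180^\circ$ about the axis (for $\mathbf b$, $\mathbf c$: about some line parallel to it meeting $\mathbf a$); $2'$ (second position only) is a screw, i.e. $180^\circ$ rotation about $\mathbf a$ together with a translation parallel to $\mathbf a$; $\tilde 2$ (fourth position only) is roto-reflection, i.e. $180^\circ$ rotation about a line parallel to $\mathbf c$ together with reflection in the frieze plane. Two symbols applying to the same axis are stacked. In terms of quadruples, the symbols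 in the various positions are: second position: $\mathrm m=(-1,t,+,+)$, $2=(+1,0,-,-)$, $2'=(+1,T/2,-,-)$; third position: $\mathrm m=(+1,0,-,+)$, $\mathrm a=(+1,T/2,-,+)$, $2=(-1,t,+,-)$; fourth position: $\mathrm m=(+1,0,+,-)$, $\mathrm a=(+1,T/2,+,-)$, $2=(-1,t,-,+)$, $\tilde 2=(-1,t,-,-)$ (with $t$ some real number). A frieze is of the type with a given label if $G$ is generated by its translations and symmetries of the kinds shown by the symbols in the label. If several symbols with $s=-1$ appear, they arise from one another by composition with elements with $s=+1$, so only one of them together with the symbols with $s=+1$ need be taken as generators. The 31 types are: $\mathrm{p111}$, $\mathrm{pm11}$, $\mathrm{p112}$, $\mathrm{p121}$, $\mathrm{p}11\tilde2$, $\mathrm{p1m1}$, $\mathrm{pmm2}$, $\mathrm{p}1\stackrel{2}{\mathrm m}1$, $\mathrm{p1a1}$, $\mathrm{pma2}$, $\mathrm{p}1\stackrel{2}{\mathrm a}1$, $\mathrm{p11m}$, $\mathrm{pm2m}$, $\mathrm{p}11\stackrel{2}{\mathrm m}$, $\mathrm{p11a}$, $\mathrm{pm2a}$, $\mathrm{p}11\stackrel{2}{\mathrm a}$, $\mathrm{p211}$, $\mathrm{p}\stackrel{2}{\mathrm m}11$, $\mathrm{p222}$, $\mathrm{p}2'11$, $\mathrm{p}\stackrel{2'}{\mathrm m}11$, $\mathrm{p}2'22$, $\mathrm{p2mm}$, $\mathrm{pmmm}$, $\mathrm{p}2'\mathrm{am}$, $\mathrm{pmam}$, $\mathrm{p}2'\mathrm{ma}$,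 $\mathrm{pmma}$, $\mathrm{p2aa}$, $\mathrm{pmaa}$ (in $\mathrm{pmmm}$, $\mathrm{pmam}$, $\mathrm{pmma}$, $\mathrm{pmaa}$ the three displayed symbols generate, with the translations, the whole group). A type is realised in hitomezashi if some hitomezashi two-sided frieze is of that type. *)

theory Defs
  imports "HOL-Analysis.Analysis" "HOL-Algebra.Generated_Groups"
begin

(* Binary digits are booleans (True for 1).  The finite word y_1 ... y_n is the list y, so that
   y_j is y ! (j - 1).  An edge is the closed unit segment between two grid points of the plane. *)

definition periodic :: "(int \<Rightarrow> bool) \<Rightarrow> bool" where
  "periodic x \<longleftrightarrow> (\<exists>p>0. \<forall>i. x (i + p) = x i)"

definition vert_edge :: "int \<Rightarrow> nat \<Rightarrow> (real \<times> real) set" where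
  "vert_edge i j = closed_segment (of_int i, of_nat j) (of_int i, of_nat (j + 1))"

definition horiz_edge :: "int \<Rightarrow> nat \<Rightarrow> (real \<times> real) set" where
  "horiz_edge i j = closed_segment (of_int i, of_nat j) (of_int (i + 1), of_nat j)"

definition grid_edges :: "nat \<Rightarrow> (real \<times> real) set set" where
  "grid_edges n = {vert_edge i j | i j. 1 \<le> j \<and> j < n} \<union> {horiz_edge i j | i j. 1 \<le> j \<and> j \<le> n}"

definition front_stitches :: "(int \<Rightarrow> bool) \<Rightarrow> bool list \<Rightarrow> (real \<times> real) set set" where
  "front_stitches x y =
     {vert_edge i j | i j. 1 \<le> j \<and> j < length y \<and> (x i \<and> odd j \<or> \<not> x i \<and> even j)} \<union>
     {horiz_edge i j | i j. 1 \<le> j \<and> j \<le> length y \<and>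
        (y ! (j - 1) \<and> even i \<or> \<not> y ! (j - 1) \<and> odd i)}"

definition back_stitches :: "(int \<Rightarrow> bool) \<Rightarrow> bool list \<Rightarrow> (real \<times> real) set set" where
  "back_stitches x y = grid_edges (length y) - front_stitches x y"

(* Candidate isometries (s, t, e, d); their planar part acts on a strip of n rows. *)

type_synonym isom = "int \<times> real \<times> int \<times> int"

fun plane_act :: "nat \<Rightarrow> isom \<Rightarrow> real \<times> real \<Rightarrow> real \<times> real" where
  "plane_act n (s, t, e, d) (X, Y) = (of_int s * X + t, if e = 1 then Y else of_nat n + 1 - Y)"

fun isom_comp :: "isom \<Rightarrow> isom \<Rightarrow> isom" where
  "isom_comp (s, t, e, d) (s', t', e', d') = (s * s', of_int s * t' + t, e * e', d * d')"

definition isom_group :: "isom monoid" where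
  "isom_group = \<lparr>carrier = {-1, 1} \<times> UNIV \<times> {-1, 1} \<times> {-1, 1},
                 mult = isom_comp, one = (1, 0, 1, 1)\<rparr>"

lemma group_isom_group: "group isom_group"
proof (rule groupI)
  fix g assume "g \<in> carrier isom_group"
  then obtain s t e d where g: "g = (s, t, e, d)"
      "s \<in> {-1, 1}" "e \<in> {-1, 1}" "d \<in> {-1, 1}"
    by (auto simp: isom_group_def)
  then have "(s, - of_int s * t, e, d) \<in> carrier isom_group \<and>
      (s, - of_int s * t, e, d) \<otimes>\<^bsub>isom_group\<^esub> g = \<one>\<^bsub>isom_group\<^esub>"
    by (auto simp: isom_group_def)
  then show "\<exists>h\<in>carrier isom_group. h \<otimes>\<^bsub>isom_group\<^esub> g = \<one>\<^bsub>isom_group\<^esub>"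
    by blast
qed (auto simp: isom_group_def algebra_simps)

lemma plane_act_comp:
  assumes "g \<in> carrier isom_group" "h \<in> carrier isom_group"
  shows "plane_act n (g \<otimes>\<^bsub>isom_group\<^esub> h) P = plane_act n g (plane_act n h P)"
  using assms by (cases P) (auto simp: isom_group_def algebra_simps)

definition edge_act :: "nat \<Rightarrow> isom \<Rightarrow> (real \<times> real) set set \<Rightarrow> (real \<times> real) set set" where
  "edge_act n g E = (\<lambda>edge. plane_act n g ` edge) ` E"

fun is_symmetry :: "nat \<Rightarrow> (real \<times> real) set set \<Rightarrow> (real \<times> real) set set \<Rightarrow> isom \<Rightarrow> bool" where
  "is_symmetry n F B (s, t, e, d) \<longleftrightarrow>
     (if d = 1 then edge_act n (s, t, e, d) F = F \<and> edge_act n (s, t, e, d) B = B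
      else edge_act n (s, t, e, d) F = B \<and> edge_act n (s, t, e, d) B = F)"

definition symmetries :: "(int \<Rightarrow> bool) \<Rightarrow> bool list \<Rightarrow> isom set" where
  "symmetries x y = {g \<in> carrier isom_group. is_symmetry (length y) (front_stitches x y) (back_stitches x y) g}"

(* The symbols m, a, 2, 2' and 2-tilde. *)

datatype sym = Mirror | Glide | Rot | Screw | RotoRefl

(* A label is the triple of the sets of symbols stacked in its second, third and fourth
   positions (axes a, b, c); the placeholder 1 is the empty set. *)

type_synonym label = "sym set \<times> sym set \<times> sym set"

(* The isometries denoted by a symbol, when the translations are the multiples of T.
   A symbol that does not occur in a given position denotes none. *)

fun kind_a :: "real \<Rightarrow> sym \<Rightarrow> isom set" where
  "kind_a T Mirror = {(-1, t, 1, 1) | t. True}"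
| "kind_a T Rot = {(1, 0, -1, -1)}"
| "kind_a T Screw = {(1, T / 2, -1, -1)}"
| "kind_a T _ = {}"

fun kind_b :: "real \<Rightarrow> sym \<Rightarrow> isom set" where
  "kind_b T Mirror = {(1, 0, -1, 1)}"
| "kind_b T Glide = {(1, T / 2, -1, 1)}"
| "kind_b T Rot = {(-1, t, 1, -1) | t. True}"
| "kind_b T _ = {}"

fun kind_c :: "real \<Rightarrow> sym \<Rightarrow> isom set" where
  "kind_c T Mirror = {(1, 0, 1, -1)}"
| "kind_c T Glide = {(1, T / 2, 1, -1)}"
| "kind_c T Rot = {(-1, t, -1, 1) | t. True}"
| "kind_c T RotoRefl = {(-1, t, -1, -1) | t. True}"
| "kind_c T _ = {}"

fun kinds :: "real \<Rightarrow> label \<Rightarrow> isom set set" where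
  "kinds T (A, B, C) = kind_a T ` A \<union> kind_b T ` B \<union> kind_c T ` C"

(* Every displayed symbol has to occur in G, and the translations together with the symmetries
   of the displayed kinds have to generate all of G. *)

definition has_type :: "isom set \<Rightarrow> label \<Rightarrow> bool" where
  "has_type G L \<longleftrightarrow>
     (\<exists>T>0. {t. (1, t, 1, 1) \<in> G} = range (\<lambda>k::int. of_int k * T) \<and>
        (\<forall>K\<in>kinds T L. K \<inter> G \<noteq> {}) \<and>
        generate isom_group ({(1, t, 1, 1) | t. (1, t, 1, 1) \<in> G} \<union> (\<Union>(kinds T L) \<inter> G)) = G)"

definition realised :: "label \<Rightarrow> bool" where
  "realised L \<longleftrightarrow> (\<exists>x y. periodic x \<and> length y \<ge> 2 \<and> has_type (symmetries x y) L)"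

definition "p111 = (({}, {}, {}) :: label)"
definition "p112 = (({}, {}, {Rot}) :: label)"
definition "p11_2tilde = (({}, {}, {RotoRefl}) :: label)"
definition "p11a = (({}, {}, {Glide}) :: label)"
definition "p11_2_over_a = (({}, {}, {Rot, Glide}) :: label)"
definition "p1a1 = (({}, {Glide}, {}) :: label)"
definition "p1m1 = (({}, {Mirror}, {}) :: label)"
definition "pm11 = (({Mirror}, {}, {}) :: label)"
definition "pma2 = (({Mirror}, {Glide}, {Rot}) :: label)"
definition "pmm2 = (({Mirror}, {Mirror}, {Rot}) :: label)"
definition "p2'11 = (({Screw}, {}, {}) :: label)"
definition "p_2'_over_m_11 = (({Screw, Mirror}, {}, {}) :: label)"
definition "p2'ma = (({Screw}, {Mirror}, {Glide}) :: label)"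

end

theory Submission
  imports Defs
begin

text \<open>
  A candidate \<open>(s, t, e, d)\<close> can only be a symmetry if \<open>t\<close> is an integer \<open>k\<close>, and then it permutes
  the grid edges. Whether an edge is stitched is the exclusive or of its digit and a parity (of the
  row for a vertical edge, of the column for a horizontal one), so comparing an edge with its image
  cancels these parities down to a constant. What remains (\<open>mem_symmetries_iff\<close>) is one condition on
  each word: the line map \<open>i \<mapsto> s i + k\<close> carries \<open>x\<close> to itself or to its complement, and \<open>y\<close> (reversed
  if \<open>e = -1\<close>) equals itself or its complement, where the choice between the word and its complement
  is dictated by the signs \<open>s, e, d\<close> and the parities of \<open>n\<close> and \<open>k\<close>.

  The condition on \<open>y\<close> depends only on how \<open>y\<close> behaves under reversal, and on the parity of \<open>n\<close>.
  Four words cover what can happen: \<open>001\<close> (reversal gives neither the word nor its complement),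
  \<open>00\<close> (palindrome of even length), \<open>01\<close> (reversal complements) and \<open>000\<close> (palindrome of odd
  length). For \<open>x\<close> four periodic words suffice, and every type is an entry of the following table,
  where the translation length \<open>T\<close> is the least even period of \<open>x\<close>:

  \<^item> \<open>x\<close> constant: pm11, pmm2, pma2, p2'/m 11 for \<open>y\<close> = 001, 00, 01, 000 (\<open>T = 2\<close>);
  \<^item> \<open>x\<close> alternating: p11a, p2'ma, p11 2/a for \<open>y\<close> = 001, 00, 01 (\<open>T = 2\<close>);
  \<^item> \<open>x\<close> the indicator of the multiples of 4: p111, p1m1, p112, p11 2-tilde for \<open>y\<close> =
    001, 00, 01, 000 (\<open>T = 4\<close>);
  \<^item> \<open>x\<close> a word of period 7 without reflections: p1a1 and p2'11 for \<open>y\<close> = 01 and 000 (\<open>T = 14\<close>).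

  That the displayed symbols generate the whole group is a matter of point groups: two symmetries
  with the same \<open>(s, e, d)\<close> differ by a translation that is itself a symmetry, so it suffices that
  the triples of the displayed symmetries generate all triples that occur (\<open>has_typeI\<close>).
\<close>

section \<open>The action of an isometry on the grid edges\<close>

lemma plane_act_segment:
  "plane_act n g ` closed_segment a b = closed_segment (plane_act n g a) (plane_act n g b)"
proof -
  obtain s t e d where g: "g = (s, t, e, d)" by (cases g)
  define L :: "real \<times> real \<Rightarrow> real \<times> real"
    where "L = (\<lambda>P. (of_int s * fst P, if e = 1 then snd P else - snd P))"
  define c :: "real \<times> real" where "c = (t, if e = 1 then 0 else of_nat n + 1)"
  have L: "linear L"
    by (rule linearI) (auto simp: L_def algebra_simps)
  have act: "plane_act n g = (\<lambda>P. c + P) \<circ> L"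
    by (rule ext) (auto simp: g L_def c_def split: prod.splits)
  show ?thesis
    unfolding act image_comp[symmetric] closed_segment_linear_image[OF L, symmetric]
      closed_segment_translation[symmetric] by simp
qed

lemma vert_edge_eq_iff [simp]: "vert_edge i j = vert_edge i' j' \<longleftrightarrow> i = i' \<and> j = j'"
  unfolding vert_edge_def closed_segment_eq by (auto simp: doubleton_eq_iff)

lemma horiz_edge_eq_iff [simp]: "horiz_edge i j = horiz_edge i' j' \<longleftrightarrow> i = i' \<and> j = j'"
  unfolding horiz_edge_def closed_segment_eq by (auto simp: doubleton_eq_iff)

lemma vert_edge_neq_horiz_edge [simp]:
  "vert_edge i j \<noteq> horiz_edge i' j'" "horiz_edge i' j' \<noteq> vert_edge i j"
  unfolding vert_edge_def horiz_edge_def closed_segment_eq by (auto simp: doubleton_eq_iff)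

lemma vert_edge_in_grid [simp]: "vert_edge i j \<in> grid_edges n \<longleftrightarrow> 1 \<le> j \<and> j < n"
  and horiz_edge_in_grid [simp]: "horiz_edge i j \<in> grid_edges n \<longleftrightarrow> 1 \<le> j \<and> j \<le> n"
  by (auto simp: grid_edges_def)

lemma vert_edge_in_front:
  "vert_edge i j \<in> front_stitches x y \<longleftrightarrow> 1 \<le> j \<and> j < length y \<and> (x i \<longleftrightarrow> odd j)"
  by (auto simp: front_stitches_def)

lemma horiz_edge_in_front:
  "horiz_edge i j \<in> front_stitches x y \<longleftrightarrow>
     1 \<le> j \<and> j \<le> length y \<and> (y ! (j - 1) \<longleftrightarrow> even i)"
  by (auto simp: front_stitches_def)

lemma front_subset_grid: "front_stitches x y \<subseteq> grid_edges (length y)"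
  by (auto simp: front_stitches_def grid_edges_def)

lemma ball_grid_edges:
  "(\<forall>a\<in>grid_edges n. P a) \<longleftrightarrow>
     (\<forall>i j. 1 \<le> j \<and> j < n \<longrightarrow> P (vert_edge i j)) \<and> (\<forall>i j. 1 \<le> j \<and> j \<le> n \<longrightarrow> P (horiz_edge i j))"
  unfolding grid_edges_def by blast

lemma plane_act_vert_edge:
  assumes "s \<in> {-1, 1}" "e \<in> {-1, 1}" "j < n"
  shows "plane_act n (s, of_int k, e, d) ` vert_edge i j =
           vert_edge (s * i + k) (if e = 1 then j else n - j)"
  using assms unfolding vert_edge_def plane_act_segment
  by (auto simp: closed_segment_eq of_nat_diff doubleton_eq_iff)

text \<open>A horizontal edge is indexed by its left end, which under \<open>s = -1\<close> is the image of the right end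
  of the original edge; hence \<open>k - 1 - i\<close>. This shift by one is why the parity of \<open>k\<close> acts
  oppositely for \<open>s = 1\<close> and \<open>s = -1\<close>.\<close>

lemma plane_act_horiz_edge:
  assumes "s \<in> {-1, 1}" "e \<in> {-1, 1}" "j \<le> n"
  shows "plane_act n (s, of_int k, e, d) ` horiz_edge i j =
           horiz_edge (if s = 1 then i + k else k - 1 - i) (if e = 1 then j else n + 1 - j)"
  using assms unfolding horiz_edge_def plane_act_segment
  by (auto simp: closed_segment_eq of_nat_diff doubleton_eq_iff algebra_simps)

text \<open>A vertical edge, which exists because \<open>n \<ge> 2\<close>, pins \<open>t\<close> to an integer: its image has to be
  a grid edge, whose end points have integral abscissae.\<close>

lemma edge_act_grid_iff:
  assumes "s \<in> {-1, 1}" "e \<in> {-1, 1}" "n \<ge> 2"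
  shows "edge_act n (s, t, e, d) (grid_edges n) = grid_edges n \<longleftrightarrow> t \<in> \<int>"
proof
  assume "edge_act n (s, t, e, d) (grid_edges n) = grid_edges n"
  moreover have "vert_edge 0 1 \<in> grid_edges n" using assms by simp
  ultimately have "plane_act n (s, t, e, d) ` vert_edge 0 1 \<in> grid_edges n"
    unfolding edge_act_def by blast
  then show "t \<in> \<int>"
    unfolding vert_edge_def plane_act_segment grid_edges_def horiz_edge_def
    by (auto simp: closed_segment_eq doubleton_eq_iff)
next
  assume "t \<in> \<int>"
  then obtain k where t: "t = of_int k" by (auto elim: Ints_cases)
  let ?f = "\<lambda>a. plane_act n (s, of_int k, e, d) ` a"
  have "?f ` grid_edges n \<subseteq> grid_edges n"
    unfolding image_subset_iff ball_grid_edges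
    using assms by (auto simp: plane_act_vert_edge plane_act_horiz_edge)
  moreover have "\<forall>a\<in>grid_edges n. a \<in> ?f ` grid_edges n"
    unfolding ball_grid_edges
  proof (intro conjI allI impI)
    fix i j assume "1 \<le> j \<and> j < n"
    then show "vert_edge i j \<in> ?f ` grid_edges n"
      using assms
      by (intro image_eqI[of _ _ "vert_edge (s * (i - k)) (if e = 1 then j else n - j)"])
         (auto simp: plane_act_vert_edge)
  next
    fix i j assume j: "1 \<le> j \<and> j \<le> n"
    let ?i = "if s = 1 then i - k else k - 1 - i" and ?j = "if e = 1 then j else n + 1 - j"
    have "?j \<le> n" using j by auto
    then have "?f (horiz_edge ?i ?j) = horiz_edge i j"
      using j assms by (subst plane_act_horiz_edge) auto
    moreover have "horiz_edge ?i ?j \<in> grid_edges n"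
      using j by auto
    ultimately show "horiz_edge i j \<in> ?f ` grid_edges n" by (metis image_eqI)
  qed
  ultimately show "edge_act n (s, t, e, d) (grid_edges n) = grid_edges n"
    unfolding edge_act_def t by blast
qed

section \<open>Symmetry as a condition on the two words\<close>

lemma image_eq_of_preimage:
  assumes "f ` E = E" "F \<subseteq> E" "F' \<subseteq> E" "\<forall>a\<in>E. f a \<in> F' \<longleftrightarrow> a \<in> F"
  shows "f ` F = F'"
proof
  show "f ` F \<subseteq> F'" using assms(2,4) by blast
  show "F' \<subseteq> f ` F"
  proof
    fix b assume b: "b \<in> F'"
    then obtain a where "a \<in> E" "b = f a" using assms(1,3) by blast
    with b show "b \<in> f ` F" using assms(4) by blast
  qed
qed

text \<open>The two set equations for front and back say, edge by edge, that the permutation induced on the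
  grid preserves (or exchanges) membership in \<open>F\<close>.\<close>

lemma is_symmetry_iff:
  assumes "F \<subseteq> E" "d \<in> {-1, 1}"
  shows "is_symmetry n F (E - F) (s, t, e, d) \<longleftrightarrow>
           edge_act n (s, t, e, d) E = E \<and>
           (\<forall>a\<in>E. plane_act n (s, t, e, d) ` a \<in> F \<longleftrightarrow> (a \<in> F \<longleftrightarrow> d = 1))"
    (is "?S \<longleftrightarrow> ?E \<and> ?A")
proof (intro iffI conjI)
  let ?f = "\<lambda>a. plane_act n (s, t, e, d) ` a"
  assume S: ?S
  have "?f ` E = ?f ` F \<union> ?f ` (E - F)"
    using assms(1) by blast
  then show ?E
    using S assms by (auto simp: edge_act_def split: if_splits)
  show ?A
  proof (intro ballI)
    fix a assume "a \<in> E"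
    moreover have "a \<in> F \<Longrightarrow> ?f a \<in> ?f ` F" "a \<in> E - F \<Longrightarrow> ?f a \<in> ?f ` (E - F)" by blast+
    ultimately show "?f a \<in> F \<longleftrightarrow> (a \<in> F \<longleftrightarrow> d = 1)"
      using S by (cases "a \<in> F"; cases "d = 1") (auto simp: edge_act_def)
  qed
next
  let ?f = "\<lambda>a. plane_act n (s, t, e, d) ` a"
  assume A: "?E \<and> ?A"
  then have surj: "?f ` E = E" by (simp add: edge_act_def)
  show ?S
  proof (cases "d = 1")
    case True
    have "?f ` F = F" "?f ` (E - F) = E - F"
      by (rule image_eq_of_preimage[OF surj]; use A True assms(1) surj in blast)+
    with True show ?thesis by (simp add: edge_act_def)
  next
    case False
    have "?f ` F = E - F" "?f ` (E - F) = F"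
      by (rule image_eq_of_preimage[OF surj]; use A False assms(1) surj in blast)+
    with False show ?thesis by (simp add: edge_act_def)
  qed
qed

text \<open>Here \<open>b\<close> and \<open>a\<close> stand for the digits governing an edge and its image, \<open>p\<close> for the parity that
  enters the stitch rule, \<open>c\<close> for the change of that parity, and \<open>m\<close> for the exchange of sides. The
  parity cancels, which makes the condition independent of the edge's position along its line.\<close>

lemma xor_transport:
  "((a = (p \<noteq> c)) = ((b = p) = (\<not> m))) = (a = (b \<noteq> (m \<noteq> c)))"
  by auto

lemma all_rows_shift: "(\<forall>i j. 1 \<le> j \<and> j \<le> n \<longrightarrow> P i j) \<longleftrightarrow> (\<forall>i. \<forall>j<n. P i (Suc j))"
proof (intro iffI allI impI)
  fix i j assume "\<forall>i. \<forall>j<n. P i (Suc j)" "1 \<le> j \<and> j \<le> n"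
  then show "P i j" by (cases j) auto
qed auto

text \<open>The two conditions come from vertical and horizontal edges. The turn \<open>e = -1\<close> sends row \<open>j\<close> of the
  vertical edges to row \<open>n - j\<close>, so it changes the parity of the row iff \<open>n\<close> is odd; the term
  \<open>odd k = (s = 1)\<close> is the change of parity of the column of a horizontal edge.\<close>

lemma mem_symmetries_iff:
  assumes "length y \<ge> 2"
  shows "(s, t, e, d) \<in> symmetries x y \<longleftrightarrow>
    s \<in> {-1, 1} \<and> e \<in> {-1, 1} \<and> d \<in> {-1, 1} \<and>
    (\<exists>k. t = of_int k \<and>
       (\<forall>i. x (s * i + k) = (x i \<noteq> ((d = -1) \<noteq> (e = -1 \<and> odd (length y))))) \<and>
       (if e = 1 then y else rev y) = map (\<lambda>b. b \<noteq> ((d = -1) \<noteq> (odd k = (s = 1)))) y)"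
proof (cases "s \<in> {-1, 1} \<and> e \<in> {-1, 1} \<and> d \<in> {-1, 1}")
  case False
  then show ?thesis by (auto simp: symmetries_def isom_group_def)
next
  case sed: True
  let ?n = "length y"
  have side: "d = 1 \<longleftrightarrow> \<not> d = -1" using sed by auto
  have vert: "(plane_act ?n (s, of_int k, e, d) ` vert_edge i j \<in> front_stitches x y \<longleftrightarrow>
          (vert_edge i j \<in> front_stitches x y \<longleftrightarrow> d = 1)) \<longleftrightarrow>
      x (s * i + k) = (x i \<noteq> ((d = -1) \<noteq> (e = -1 \<and> odd ?n)))"
    if j: "1 \<le> j" "j < ?n" for k i j
  proof -
    let ?j = "if e = 1 then j else ?n - j"
    have rows: "1 \<le> ?j" "?j < ?n" "odd ?j = (odd j \<noteq> (e = -1 \<and> odd ?n))"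
      using j sed by auto
    have "plane_act ?n (s, of_int k, e, d) ` vert_edge i j = vert_edge (s * i + k) ?j"
      using sed j by (intro plane_act_vert_edge) auto
    then have "plane_act ?n (s, of_int k, e, d) ` vert_edge i j \<in> front_stitches x y \<longleftrightarrow>
        x (s * i + k) = (odd j \<noteq> (e = -1 \<and> odd ?n))"
      by (simp only: vert_edge_in_front rows simp_thms)
    moreover have "vert_edge i j \<in> front_stitches x y \<longleftrightarrow> x i = odd j"
      using j by (simp add: vert_edge_in_front)
    ultimately show ?thesis
      unfolding side by (simp only: xor_transport)
  qed
  have V: "(\<forall>i j. 1 \<le> j \<and> j < ?n \<longrightarrow>
        (plane_act ?n (s, of_int k, e, d) ` vert_edge i j \<in> front_stitches x y \<longleftrightarrow>
          (vert_edge i j \<in> front_stitches x y \<longleftrightarrow> d = 1))) \<longleftrightarrow>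
      (\<forall>i. x (s * i + k) = (x i \<noteq> ((d = -1) \<noteq> (e = -1 \<and> odd ?n))))" (is "?L \<longleftrightarrow> ?R") for k
  proof -
    have "?L \<longleftrightarrow> (\<forall>i j. 1 \<le> j \<and> j < ?n \<longrightarrow>
        x (s * i + k) = (x i \<noteq> ((d = -1) \<noteq> (e = -1 \<and> odd ?n))))"
      by (simp only: vert cong: imp_cong conj_cong)
    also have "\<dots> \<longleftrightarrow> ?R"
    proof -
      \<comment> \<open>The condition no longer depends on \<open>j\<close>, but a row of vertical edges has to exist.\<close>
      have "(1::nat) \<le> 1 \<and> 1 < ?n" using assms by simp
      then show ?thesis by blast
    qed
    finally show ?thesis .
  qed
  have horiz: "(plane_act ?n (s, of_int k, e, d) ` horiz_edge i (Suc j) \<in> front_stitches x y \<longleftrightarrow>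
          (horiz_edge i (Suc j) \<in> front_stitches x y \<longleftrightarrow> d = 1)) \<longleftrightarrow>
      (if e = 1 then y else rev y) ! j = (y ! j \<noteq> ((d = -1) \<noteq> (odd k = (s = 1))))"
    if j: "j < ?n" for k i j
  proof -
    let ?i = "if s = 1 then i + k else k - 1 - i" and ?j = "if e = 1 then Suc j else ?n + 1 - Suc j"
    have rows: "1 \<le> ?j" "?j \<le> ?n" "y ! (?j - 1) = (if e = 1 then y else rev y) ! j"
      using j by (auto simp: rev_nth)
    have cols: "even ?i = (even i \<noteq> (odd k = (s = 1)))" by auto
    have "plane_act ?n (s, of_int k, e, d) ` horiz_edge i (Suc j) = horiz_edge ?i ?j"
      using sed j by (intro plane_act_horiz_edge) auto
    then have "plane_act ?n (s, of_int k, e, d) ` horiz_edge i (Suc j) \<in> front_stitches x y \<longleftrightarrow>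
        (if e = 1 then y else rev y) ! j = (even i \<noteq> (odd k = (s = 1)))"
      by (simp only: horiz_edge_in_front rows cols simp_thms)
    moreover have "horiz_edge i (Suc j) \<in> front_stitches x y \<longleftrightarrow> y ! j = even i"
      using j by (simp add: horiz_edge_in_front)
    ultimately show ?thesis
      unfolding side by (simp only: xor_transport)
  qed
  have H: "(\<forall>i j. 1 \<le> j \<and> j \<le> ?n \<longrightarrow>
        (plane_act ?n (s, of_int k, e, d) ` horiz_edge i j \<in> front_stitches x y \<longleftrightarrow>
          (horiz_edge i j \<in> front_stitches x y \<longleftrightarrow> d = 1))) \<longleftrightarrow>
      (if e = 1 then y else rev y) = map (\<lambda>b. b \<noteq> ((d = -1) \<noteq> (odd k = (s = 1)))) y"
    (is "(\<forall>i j. _ \<longrightarrow> ?J i j) \<longleftrightarrow> ?W") for k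
  proof -
    have "(\<forall>i j. 1 \<le> j \<and> j \<le> ?n \<longrightarrow> ?J i j) \<longleftrightarrow> (\<forall>i. \<forall>j<?n. ?J i (Suc j))"
      by (simp only: all_rows_shift)
    also have "\<dots> \<longleftrightarrow> (\<forall>j<?n. (if e = 1 then y else rev y) ! j =
        (y ! j \<noteq> ((d = -1) \<noteq> (odd k = (s = 1)))))"
      using horiz by simp
    also have "\<dots> \<longleftrightarrow> ?W"
      by (auto simp: list_eq_iff_nth_eq)
    finally show ?thesis .
  qed
  have "(s, t, e, d) \<in> symmetries x y \<longleftrightarrow>
      is_symmetry ?n (front_stitches x y) (back_stitches x y) (s, t, e, d)"
    using sed by (auto simp: symmetries_def isom_group_def)
  also have "\<dots> \<longleftrightarrow> t \<in> \<int> \<and> (\<forall>a\<in>grid_edges ?n.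
      plane_act ?n (s, t, e, d) ` a \<in> front_stitches x y \<longleftrightarrow> (a \<in> front_stitches x y \<longleftrightarrow> d = 1))"
    unfolding back_stitches_def
    using sed assms by (subst is_symmetry_iff) (auto simp: front_subset_grid edge_act_grid_iff)
  also have "\<dots> \<longleftrightarrow> (\<exists>k. t = of_int k \<and> (\<forall>a\<in>grid_edges ?n.
      plane_act ?n (s, of_int k, e, d) ` a \<in> front_stitches x y \<longleftrightarrow> (a \<in> front_stitches x y \<longleftrightarrow> d = 1)))"
    by (auto elim: Ints_cases)
  finally show ?thesis
    using sed unfolding ball_grid_edges V H by simp
qed

section \<open>Determining the type from the point group\<close>

lemma edge_act_comp:
  assumes "g \<in> carrier isom_group" "h \<in> carrier isom_group"
  shows "edge_act n (g \<otimes>\<^bsub>isom_group\<^esub> h) E = edge_act n g (edge_act n h E)"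
  using assms by (simp add: edge_act_def image_image plane_act_comp)

lemma edge_act_one: "edge_act n \<one>\<^bsub>isom_group\<^esub> E = E"
proof -
  have "plane_act n \<one>\<^bsub>isom_group\<^esub> = id"
    by (rule ext) (auto simp: isom_group_def)
  then show ?thesis by (simp add: edge_act_def)
qed

lemma subgroup_symmetries: "subgroup (symmetries x y) isom_group"
proof -
  interpret group isom_group by (rule group_isom_group)
  let ?n = "length y" and ?F = "front_stitches x y" and ?B = "back_stitches x y"
  have mem: "g \<in> symmetries x y \<longleftrightarrow> g \<in> carrier isom_group \<and>
      (if snd (snd (snd g)) = 1 then edge_act ?n g ?F = ?F \<and> edge_act ?n g ?B = ?B
       else edge_act ?n g ?F = ?B \<and> edge_act ?n g ?B = ?F)" for g
    by (cases g) (auto simp: symmetries_def)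
  have side_mult: "snd (snd (snd (g \<otimes>\<^bsub>isom_group\<^esub> h))) = snd (snd (snd g)) * snd (snd (snd h))" for g h
    by (cases g; cases h) (simp add: isom_group_def)
  have side_one: "snd (snd (snd \<one>\<^bsub>isom_group\<^esub>)) = 1" by (simp add: isom_group_def)
  have side: "snd (snd (snd g)) \<in> {-1, 1}" if "g \<in> carrier isom_group" for g
    using that by (auto simp: isom_group_def)
  show ?thesis
  proof (rule subgroupI)
    show "symmetries x y \<noteq> {}"
      using mem[of "\<one>\<^bsub>isom_group\<^esub>"] edge_act_one by (auto simp: isom_group_def)
  next
    fix g h assume gh: "g \<in> symmetries x y" "h \<in> symmetries x y"
    then show "g \<otimes>\<^bsub>isom_group\<^esub> h \<in> symmetries x y"
      using side[of g] side[of h]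
      unfolding mem by (auto simp: side_mult edge_act_comp split: if_splits)
  next
    fix g assume g: "g \<in> symmetries x y"
    then have gc: "g \<in> carrier isom_group" by (simp add: mem)
    have undo: "edge_act ?n (inv\<^bsub>isom_group\<^esub> g) (edge_act ?n g E) = E" for E
      using edge_act_comp[of "inv\<^bsub>isom_group\<^esub> g" g ?n E] gc by (simp add: edge_act_one)
    have "snd (snd (snd (inv\<^bsub>isom_group\<^esub> g))) * snd (snd (snd g)) = 1"
      using side_mult[of "inv\<^bsub>isom_group\<^esub> g" g] side_one gc by simp
    then have "snd (snd (snd (inv\<^bsub>isom_group\<^esub> g))) = snd (snd (snd g))"
      using side[OF gc] side[of "inv\<^bsub>isom_group\<^esub> g"] gc by auto
    then show "inv\<^bsub>isom_group\<^esub> g \<in> symmetries x y"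
      using g gc undo[of ?F] undo[of ?B] unfolding mem by (auto split: if_splits)
  qed (auto simp: mem)
qed

definition point_part :: "isom \<Rightarrow> int \<times> int \<times> int" where
  "point_part = (\<lambda>(s, t, e, d). (s, e, d))"

text \<open>If \<open>w\<close> is a product of displayed symmetries with the same point part as \<open>z\<close>, then \<open>z w\<inverse>\<close> is a
  translation lying in \<open>G\<close>, hence one of the generators. Two factors are
  enough for the groups below, whose point groups have at most four elements.\<close>

lemma has_typeI:
  assumes G: "subgroup G isom_group" and T: "T > 0"
    and transl: "{t. (1, t, 1, 1) \<in> G} = range (\<lambda>k::int. of_int k * T)"
    and occur: "\<And>K. K \<in> kinds T L \<Longrightarrow> K \<inter> G \<noteq> {}"
    and cover: "\<And>z. z \<in> G \<Longrightarrow>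
      \<exists>g \<in> insert (1, 0, 1, 1) (\<Union>(kinds T L) \<inter> G).
      \<exists>h \<in> insert (1, 0, 1, 1) (\<Union>(kinds T L) \<inter> G). point_part z = point_part (isom_comp g h)"
  shows "has_type G L"
proof -
  interpret group isom_group by (rule group_isom_group)
  let ?U = "{(1, t, 1, 1) | t. (1, t, 1, 1) \<in> G} \<union> (\<Union>(kinds T L) \<inter> G)"
  have carr: "G \<subseteq> carrier isom_group" using G by (rule subgroup.subset)
  have UG: "?U \<subseteq> G" by auto
  have "z \<in> generate isom_group ?U" if z: "z \<in> G" for z
  proof -
    have "(1, 0, 1, 1) = \<one>\<^bsub>isom_group\<^esub>" by (simp add: isom_group_def)
    then obtain g h where gh: "g \<in> insert \<one>\<^bsub>isom_group\<^esub> (\<Union>(kinds T L) \<inter> G)"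
        "h \<in> insert \<one>\<^bsub>isom_group\<^esub> (\<Union>(kinds T L) \<inter> G)" "point_part z = point_part (isom_comp g h)"
      using cover[OF z] by (elim bexE) simp
    define w where "w = g \<otimes>\<^bsub>isom_group\<^esub> h"
    have "g \<in> generate isom_group ?U" "h \<in> generate isom_group ?U"
      using gh by (auto intro: generate.one generate.incl)
    then have w: "w \<in> generate isom_group ?U"
      unfolding w_def by (rule generate.eng)
    have wG: "w \<in> G"
      using w generate_subgroup_incl[OF UG G] by blast
    have pz: "point_part z = point_part w"
      using gh(3) by (simp add: w_def isom_group_def)
    obtain s t e d where zv: "z = (s, t, e, d)" by (cases z)
    obtain t' where wv: "w = (s, t', e, d)"
      using pz zv by (cases w) (auto simp: point_part_def)
    have carrier: "z \<in> carrier isom_group" "w \<in> carrier isom_group"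
        "(1, t - t', 1, 1) \<in> carrier isom_group"
      using z wG carr by (auto simp: isom_group_def)
    have split: "(1, t - t', 1, 1) \<otimes>\<^bsub>isom_group\<^esub> w = z"
      by (simp add: zv wv isom_group_def)
    have "(1, t - t', 1, 1) = z \<otimes>\<^bsub>isom_group\<^esub> inv\<^bsub>isom_group\<^esub> w"
      using inv_solve_right[OF carrier(3,1,2)] split by simp
    then have "(1, t - t', 1, 1) \<in> G"
      using z wG G by (simp add: subgroup.m_closed subgroup.m_inv_closed)
    then have "(1, t - t', 1, 1) \<in> generate isom_group ?U"
      by (intro generate.incl) auto
    then show ?thesis
      using generate.eng[OF _ w] split by force
  qed
  then have "generate isom_group ?U = G"
    using generate_subgroup_incl[OF UG G] by blast
  then show ?thesis
    using T transl occur unfolding has_type_def by blast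
qed

fun lattice_isom :: "int \<times> int \<times> int \<times> int \<Rightarrow> isom" where
  "lattice_isom (s, k, e, d) = (s, of_int k, e, d)"

lemma mem_symmetries_of_int_iff:
  assumes "length y \<ge> 2"
  shows "(s, of_int k, e, d) \<in> symmetries x y \<longleftrightarrow>
    s \<in> {-1, 1} \<and> e \<in> {-1, 1} \<and> d \<in> {-1, 1} \<and>
    (\<forall>i. x (s * i + k) = (x i \<noteq> ((d = -1) \<noteq> (e = -1 \<and> odd (length y))))) \<and>
    (if e = 1 then y else rev y) = map (\<lambda>b. b \<noteq> ((d = -1) \<noteq> (odd k = (s = 1)))) y"
  unfolding mem_symmetries_iff[OF assms] of_int_eq_iff by blast

text \<open>Integral coordinates reduce everything to integers and signs. \<open>R\<close> is the symmetry condition of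
  the pair of words, and \<open>W\<close> a set of witnesses, at least one for each displayed symbol.\<close>

lemma realisedI:
  fixes m :: int and W :: "(int \<times> int \<times> int \<times> int) set"
  assumes "periodic x" "length y \<ge> 2" "m > 0"
    and sym: "\<And>s k e d. (s, of_int k, e, d) \<in> symmetries x y \<longleftrightarrow> R s k e d"
    and transl: "\<And>k. R 1 k 1 1 \<longleftrightarrow> m dvd k"
    and W_sym: "\<And>s k e d. (s, k, e, d) \<in> W \<Longrightarrow> R s k e d"
    and W_kinds: "\<And>w. w \<in> W \<Longrightarrow> lattice_isom w \<in> \<Union>(kinds (of_int m) L)"
    and occur: "\<And>K. K \<in> kinds (of_int m) L \<Longrightarrow> \<exists>w\<in>W. lattice_isom w \<in> K"
    and cover: "\<And>s k e d. R s k e d \<Longrightarrow>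
      \<exists>v \<in> insert (1, 0, 1, 1) W. \<exists>w \<in> insert (1, 0, 1, 1) W.
        (s, e, d) = point_part (isom_comp (lattice_isom v) (lattice_isom w))"
  shows "realised L"
proof -
  let ?G = "symmetries x y" and ?T = "of_int m :: real"
  have int: "\<exists>k. t = of_int k" if "(s, t, e, d) \<in> ?G" for s t e d
    using that unfolding mem_symmetries_iff[OF assms(2)] by (elim conjE exE) (rule exI)
  note transl = transl[folded sym] and W_sym = W_sym[folded sym] and cover = cover[folded sym]
  have W: "lattice_isom w \<in> \<Union>(kinds ?T L) \<inter> ?G" if "w \<in> W" for w
    using W_kinds[OF that] W_sym that by (cases w) simp
  have "has_type ?G L"
  proof (rule has_typeI[OF subgroup_symmetries])
    show "?T > 0" using \<open>m > 0\<close> by simp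
    show "{t. (1, t, 1, 1) \<in> ?G} = range (\<lambda>k::int. of_int k * ?T)"
    proof (intro equalityI subsetI)
      fix t assume "t \<in> {t. (1, t, 1, 1) \<in> ?G}"
      then have t: "(1, t, 1, 1) \<in> ?G" by simp
      then obtain k where k: "t = of_int k" using int by blast
      then have "m dvd k" using t transl by simp
      then obtain q where "k = m * q" by (rule dvdE)
      then have "t = of_int q * ?T" using k by simp
      then show "t \<in> range (\<lambda>k::int. of_int k * ?T)" by (rule range_eqI)
    next
      fix t assume "t \<in> range (\<lambda>k::int. of_int k * ?T)"
      then obtain k :: int where "t = of_int (k * m)" by auto
      then show "t \<in> {t. (1, t, 1, 1) \<in> ?G}" using transl[of "k * m"] by simp
    qed
    show "K \<inter> ?G \<noteq> {}" if "K \<in> kinds ?T L" for K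
      using occur[OF that] W by blast
  next
    fix z assume z: "z \<in> ?G"
    obtain s t e d where zv: "z = (s, t, e, d)" by (cases z)
    then obtain k where k: "t = of_int k" using z int by blast
    then obtain v w where vw: "v \<in> insert (1, 0, 1, 1) W" "w \<in> insert (1, 0, 1, 1) W"
        and point: "(s, e, d) = point_part (isom_comp (lattice_isom v) (lattice_isom w))"
      using cover[of s k e d] z zv by blast
    have displayed: "lattice_isom u \<in> insert (1, 0, 1, 1) (\<Union>(kinds ?T L) \<inter> ?G)"
      if "u \<in> insert (1, 0, 1, 1) W" for u
      using that by (elim insertE) (simp, simp add: W del: Int_iff)
    have "point_part z = point_part (isom_comp (lattice_isom v) (lattice_isom w))"
      using point by (simp add: zv point_part_def)
    then show "\<exists>g \<in> insert (1, 0, 1, 1) (\<Union>(kinds ?T L) \<inter> ?G).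
        \<exists>h \<in> insert (1, 0, 1, 1) (\<Union>(kinds ?T L) \<inter> ?G). point_part z = point_part (isom_comp g h)"
      using displayed[OF vw(1)] displayed[OF vw(2)] by blast
  qed
  then show ?thesis
    using assms(1,2) unfolding realised_def by blast
qed

section \<open>The four periodic words\<close>

lemma mem_symmetries_constant:
  assumes "length y \<ge> 2"
  shows "(s, of_int k, e, d) \<in> symmetries (\<lambda>_. True) y \<longleftrightarrow>
    s \<in> {-1, 1} \<and> e \<in> {-1, 1} \<and> d \<in> {-1, 1} \<and> (d = -1) = (e = -1 \<and> odd (length y)) \<and>
    (if e = 1 then y else rev y) = map (\<lambda>b. b \<noteq> ((d = -1) \<noteq> (odd k = (s = 1)))) y"
  by (simp add: mem_symmetries_of_int_iff[OF assms])

lemma mem_symmetries_alternating: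
  assumes "length y \<ge> 2"
  shows "(s, of_int k, e, d) \<in> symmetries even y \<longleftrightarrow>
    s \<in> {-1, 1} \<and> e \<in> {-1, 1} \<and> d \<in> {-1, 1} \<and> odd k = ((d = -1) \<noteq> (e = -1 \<and> odd (length y))) \<and>
    (if e = 1 then y else rev y) = map (\<lambda>b. b \<noteq> ((d = -1) \<noteq> (odd k = (s = 1)))) y"
proof -
  have "(\<forall>i. even (s * i + k) = (even i \<noteq> c)) \<longleftrightarrow> odd k = c" if "s \<in> {-1, 1}" for c
    using that by auto
  then show ?thesis
    unfolding mem_symmetries_of_int_iff[OF assms] by auto
qed

lemma mem_symmetries_sparse:
  assumes "length y \<ge> 2"
  shows "(s, of_int k, e, d) \<in> symmetries (\<lambda>i. 4 dvd i) y \<longleftrightarrow>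
    s \<in> {-1, 1} \<and> e \<in> {-1, 1} \<and> d \<in> {-1, 1} \<and>
    4 dvd k \<and> (d = -1) = (e = -1 \<and> odd (length y)) \<and>
    (if e = 1 then y else rev y) = map (\<lambda>b. b \<noteq> ((d = -1) \<noteq> (odd k = (s = 1)))) y"
proof -
  have "(\<forall>i. 4 dvd s * i + k = ((4 dvd i) \<noteq> c)) \<longleftrightarrow> 4 dvd k \<and> \<not> c" if s: "s \<in> {-1, 1}" for c
  proof
    assume a: "\<forall>i. 4 dvd s * i + k = ((4 dvd i) \<noteq> c)"
    \<comment> \<open>Two neighbouring integers are never both multiples of 4, which excludes a complement.\<close>
    show "4 dvd k \<and> \<not> c"
      using s a[rule_format, of 0] a[rule_format, of 1] a[rule_format, of 2]
      by (elim insertE emptyE; cases c; simp; presburger)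
  next
    assume "4 dvd k \<and> \<not> c"
    then show "\<forall>i. 4 dvd s * i + k = ((4 dvd i) \<noteq> c)"
      using s by (auto simp: dvd_add_left_iff)
  qed
  then show ?thesis
    unfolding mem_symmetries_of_int_iff[OF assms] by auto
qed

text \<open>An odd period \<open>k\<close> of \<open>x\<close> yields the glide of p1a1 if \<open>y\<close> is 01, and the screw of p2'11 if \<open>y\<close> is
  000, while a reflection of \<open>x\<close> would add further symmetries. Binary words of period at most 5 all
  have reflections. Here the ones are separated by the cyclic gaps 1, 2, 4; a reflection would turn
  them into 4, 2, 1, which is a different cyclic order.\<close>

definition chiral_word :: "int \<Rightarrow> bool" where
  "chiral_word i \<longleftrightarrow> i mod 7 \<in> {0, 1, 3}"

text \<open>The index sets are lists so that the finite check can be run by rewriting.\<close>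

lemma chiral_residues:
  "\<forall>s\<in>set [1, -1::int]. \<forall>r\<in>set [0..6]. \<forall>c\<in>set [True, False].
     (\<forall>i\<in>set [0..6::int].
        ((s * i + r) mod 7 \<in> set [0, 1, 3]) = ((i mod 7 \<in> set [0, 1, 3]) \<noteq> c)) \<longrightarrow>
     s = 1 \<and> r = 0 \<and> \<not> c"
  by code_simp

lemma mem_symmetries_chiral:
  assumes "length y \<ge> 2"
  shows "(s, of_int k, e, d) \<in> symmetries chiral_word y \<longleftrightarrow>
    s = 1 \<and> e \<in> {-1, 1} \<and> d \<in> {-1, 1} \<and>
    7 dvd k \<and> (d = -1) = (e = -1 \<and> odd (length y)) \<and>
    (if e = 1 then y else rev y) = map (\<lambda>b. b \<noteq> ((d = -1) \<noteq> odd k)) y"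
proof -
  have line: "(\<forall>i. chiral_word (s * i + k) = (chiral_word i \<noteq> c)) \<longleftrightarrow> s = 1 \<and> 7 dvd k \<and> \<not> c"
    if s: "s \<in> {-1, 1}" for c
  proof
    assume a: "\<forall>i. chiral_word (s * i + k) = (chiral_word i \<noteq> c)"
    have "((s * i + k mod 7) mod 7 \<in> set [0, 1, 3]) = ((i mod 7 \<in> set [0, 1, 3]) \<noteq> c)" for i
      using a[rule_format, of i] unfolding chiral_word_def mod_add_right_eq by simp
    then have "\<forall>i\<in>set [0..6]. ((s * i + k mod 7) mod 7 \<in> set [0, 1, 3]) =
        ((i mod 7 \<in> set [0, 1, 3]) \<noteq> c)" by (intro ballI)
    moreover have "s \<in> set [1, -1]" "k mod 7 \<in> set [0..6]" "c \<in> set [True, False]"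
      using s by auto
    ultimately have "s = 1 \<and> k mod 7 = 0 \<and> \<not> c"
      by (intro chiral_residues[THEN bspec, THEN bspec, THEN bspec, THEN mp])
    then show "s = 1 \<and> 7 dvd k \<and> \<not> c" by (simp only: dvd_eq_mod_eq_0 simp_thms)
  next
    assume "s = 1 \<and> 7 dvd k \<and> \<not> c"
    then show "\<forall>i. chiral_word (s * i + k) = (chiral_word i \<noteq> c)"
      by (elim conjE dvdE) (simp add: chiral_word_def)
  qed
  show ?thesis
  proof (cases "s \<in> {-1, 1}")
    case True
    then show ?thesis
      unfolding mem_symmetries_of_int_iff[OF assms] line[OF True] by (cases "s = 1") simp_all
  next
    case False
    then show ?thesis
      unfolding mem_symmetries_of_int_iff[OF assms] by simp
  qed
qed

lemma periodic_words:
  "periodic (\<lambda>_. True)" "periodic even" "periodic (\<lambda>i. 4 dvd i)" "periodic chiral_word"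
proof -
  show "periodic (\<lambda>_. True)" unfolding periodic_def by (intro exI[of _ 1]) simp
  show "periodic even" unfolding periodic_def by (intro exI[of _ 2]) simp
  show "periodic (\<lambda>i. 4 dvd i)" unfolding periodic_def by (intro exI[of _ 4]) simp
  show "periodic chiral_word" unfolding periodic_def by (intro exI[of _ 7]) (simp add: chiral_word_def)
qed

section \<open>The thirteen types\<close>

text \<open>The parameter \<open>m\<close> is the translation length \<open>T\<close>, so glides and screws are witnessed by
  \<open>m / 2\<close>. Where \<open>s = -1\<close>, the choice between 0 and 1 is forced by
  the parity condition on \<open>y\<close>.\<close>

lemma realised_pm11: "realised pm11"
  by (rule realisedI[OF periodic_words(1) _ _ mem_symmetries_constant, where m = 2
        and y = "[False, False, True]" and W = "{(-1, 1, 1, 1)}"];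
      auto simp: pm11_def point_part_def split: if_splits; presburger)

lemma realised_pmm2: "realised pmm2"
  by (rule realisedI[OF periodic_words(1) _ _ mem_symmetries_constant, where m = 2
        and y = "[False, False]" and W = "{(-1, 1, 1, 1), (1, 0, -1, 1), (-1, 1, -1, 1)}"];
      auto simp: pmm2_def point_part_def split: if_splits; presburger)

lemma realised_pma2: "realised pma2"
  by (rule realisedI[OF periodic_words(1) _ _ mem_symmetries_constant, where m = 2
        and y = "[False, True]" and W = "{(-1, 1, 1, 1), (1, 1, -1, 1), (-1, 0, -1, 1)}"];
      auto simp: pma2_def point_part_def split: if_splits; presburger)

lemma realised_p_2'_over_m_11: "realised p_2'_over_m_11"
  by (rule realisedI[OF periodic_words(1) _ _ mem_symmetries_constant, where m = 2
        and y = "[False, False, False]" and W = "{(1, 1, -1, -1), (-1, 1, 1, 1)}"];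
      auto simp: p_2'_over_m_11_def point_part_def split: if_splits; presburger)

lemma realised_p11a: "realised p11a"
  by (rule realisedI[OF periodic_words(2) _ _ mem_symmetries_alternating, where m = 2
        and y = "[False, False, True]" and W = "{(1, 1, 1, -1)}"];
      auto simp: p11a_def point_part_def split: if_splits; presburger)

lemma realised_p2'ma: "realised p2'ma"
  by (rule realisedI[OF periodic_words(2) _ _ mem_symmetries_alternating, where m = 2
        and y = "[False, False]" and W = "{(1, 1, -1, -1), (1, 0, -1, 1), (1, 1, 1, -1)}"];
      auto simp: p2'ma_def point_part_def split: if_splits; presburger)

lemma realised_p11_2_over_a: "realised p11_2_over_a"
  by (rule realisedI[OF periodic_words(2) _ _ mem_symmetries_alternating, where m = 2
        and y = "[False, True]" and W = "{(-1, 0, -1, 1), (1, 1, 1, -1)}"];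
      auto simp: p11_2_over_a_def point_part_def split: if_splits; presburger)

lemma realised_p111: "realised p111"
  by (rule realisedI[OF periodic_words(3) _ _ mem_symmetries_sparse, where m = 4
        and y = "[False, False, True]" and W = "{}"];
      auto simp: p111_def point_part_def split: if_splits; presburger)

lemma realised_p1m1: "realised p1m1"
  by (rule realisedI[OF periodic_words(3) _ _ mem_symmetries_sparse, where m = 4
        and y = "[False, False]" and W = "{(1, 0, -1, 1)}"];
      auto simp: p1m1_def point_part_def split: if_splits; presburger)

lemma realised_p112: "realised p112"
  by (rule realisedI[OF periodic_words(3) _ _ mem_symmetries_sparse, where m = 4
        and y = "[False, True]" and W = "{(-1, 0, -1, 1)}"];
      auto simp: p112_def point_part_def split: if_splits; presburger)

lemma realised_p11_2tilde: "realised p11_2tilde"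
  by (rule realisedI[OF periodic_words(3) _ _ mem_symmetries_sparse, where m = 4
        and y = "[False, False, False]" and W = "{(-1, 0, -1, -1)}"];
      auto simp: p11_2tilde_def point_part_def split: if_splits; presburger)

lemma realised_p1a1: "realised p1a1"
  by (rule realisedI[OF periodic_words(4) _ _ mem_symmetries_chiral, where m = 14
        and y = "[False, True]" and W = "{(1, 7, -1, 1)}"];
      auto simp: p1a1_def point_part_def split: if_splits; presburger)

lemma realised_p2'11: "realised p2'11"
  by (rule realisedI[OF periodic_words(4) _ _ mem_symmetries_chiral, where m = 14
        and y = "[False, False, False]" and W = "{(1, 7, -1, -1)}"];
      auto simp: p2'11_def point_part_def split: if_splits; presburger)

theorem mainTheorem4:
  shows "\<forall>L \<in> {p111, p112, p11_2tilde, p11a, p11_2_over_a, p1a1, p1m1, pm11, pma2, pmm2,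
                p2'11, p_2'_over_m_11, p2'ma}. realised L"
  by (simp add: realised_p111 realised_p112 realised_p11_2tilde realised_p11a
      realised_p11_2_over_a realised_p1a1 realised_p1m1 realised_pm11 realised_pma2
      realised_pmm2 realised_p2'11 realised_p_2'_over_m_11 realised_p2'ma)

end
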